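(* Let $q\in\mathbb{C}$ with $|q|<1$. Define $$\Omega_1 := \frac{f(q^{4}, q^{6})}{f(-q, -q^{9})}, \qquad \Omega_2 := q\,\frac{f(q^2, q^{8})}{f(-q^3, -q^{7})}.$$ Then $$\Omega_1^2+\Omega_2^2 = \frac{\psi^4(q^2)}{\psi^4(-q^5)} + \frac{q^4\psi^4(q^{10})}{\psi^4(-q^5)} - \frac{2q^2\psi^2(q^2)\psi^2(q^{10})}{\psi^4(-q^5)} + \frac{2q\,\varphi(-q^{10})\psi(-q)}{\varphi(-q)\psi(q^5)}.$$
   Context: For $|rs|<1$, Ramanujan's general theta function is $f(r,s)=\sum_{n=-\infty}^{\infty} r^{n(n+1)/2}s^{n(n-1)/2}$. Also $\varphi(q)=f(q,q)=\sum_{n=-\infty}^{\infty}q^{n^2}$ and $\psi(q)=f(q,q^3)=\sum_{n\ge0}q^{n(n+1)/2}$. *)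

theory Defs
  imports "HOL-Analysis.Analysis"
begin

(* Both exponents are nonnegative integers for every n :: int, so nat and div lose nothing,
   and 0 ^ 0 = 1 gives the usual value 1 at r = s = 0. For |rs| < 1 the bilateral series
   converges absolutely, so infsum is its value. *)
definition ramanujan_f :: "complex \<Rightarrow> complex \<Rightarrow> complex" where
  "ramanujan_f r s =
     (\<Sum>\<^sub>\<infinity>n\<in>(UNIV :: int set). r ^ nat (n * (n + 1) div 2) * s ^ nat (n * (n - 1) div 2))"

definition ramanujan_phi :: "complex \<Rightarrow> complex" where
  "ramanujan_phi q = ramanujan_f q q"

definition ramanujan_psi :: "complex \<Rightarrow> complex" where
  "ramanujan_psi q = ramanujan_f q (q ^ 3)"

definition Omega1 :: "complex \<Rightarrow> complex" where
  "Omega1 q = ramanujan_f (q ^ 4) (q ^ 6) / ramanujan_f (- q) (- (q ^ 9))"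

definition Omega2 :: "complex \<Rightarrow> complex" where
  "Omega2 q = q * (ramanujan_f (q ^ 2) (q ^ 8) / ramanujan_f (- (q ^ 3)) (- (q ^ 7)))"

end

theory Submission
  imports Defs
begin

text \<open>
  The right-hand side is \<open>(\<Omega>\<^sub>1 - \<Omega>\<^sub>2)\<^sup>2 + 2 \<Omega>\<^sub>1 \<Omega>\<^sub>2\<close>: one has
  \<open>\<Omega>\<^sub>1 - \<Omega>\<^sub>2 = (\<psi>\<^sup>2(q\<^sup>2) - q\<^sup>2 \<psi>\<^sup>2(q\<^bsup>10\<^esup>)) / \<psi>\<^sup>2(-q\<^sup>5)\<close>, while
  \<open>\<Omega>\<^sub>1 \<Omega>\<^sub>2\<close> is computed by the Jacobi triple product, which also shows that no denominator
  vanishes.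

  For the difference, the numerator \<open>\<psi>\<^sup>2(q\<^sup>2) - q\<^sup>2 \<psi>\<^sup>2(q\<^bsup>10\<^esup>)\<close> equals
  \<open>f(q\<^sup>2, q\<^sup>8) f(q\<^sup>4, q\<^sup>6)\<close>, and \<open>2 \<psi>\<^sup>2(-q\<^sup>5) = f(1, q\<^bsup>10\<^esup>) f(-q\<^sup>5, -q\<^sup>5)\<close>. After
  clearing denominators every term is a product of pairs of theta functions of nome \<open>q\<^bsup>10\<^esup>\<close>;
  rewriting each pair in terms of \<open>f(q\<^sup>k, q\<^bsup>20-k\<^esup>)\<close> with \<open>k = 2, 4, 6, 8\<close> leaves a polynomial
  identity.
\<close>

section \<open>Theta series\<close>

definition choose2 :: "int \<Rightarrow> int" where
  "choose2 n = n * (n - 1) div 2"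

lemma two_choose2: "2 * choose2 n = n * (n - 1)"
  unfolding choose2_def by (cases "even n") auto

lemma choose2_add: "choose2 (u + v) = choose2 u + choose2 v + u * v"
proof -
  have "2 * choose2 (u + v) = 2 * (choose2 u + choose2 v + u * v)"
    unfolding distrib_left two_choose2 by (simp add: algebra_simps)
  thus ?thesis by simp
qed

lemma choose2_minus: "choose2 (- n) = choose2 n + n"
proof -
  have "2 * choose2 (- n) = 2 * (choose2 n + n)"
    unfolding distrib_left two_choose2 by (simp add: algebra_simps)
  thus ?thesis by simp
qed

lemma choose2_0 [simp]: "choose2 0 = 0" and choose2_1 [simp]: "choose2 1 = 0"
  and choose2_2 [simp]: "choose2 2 = 1"
  by (simp_all add: choose2_def)

lemma choose2_nonneg: "choose2 n \<ge> 0"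
proof -
  have "n * (n - 1) \<ge> 0" by (cases "n \<ge> 1") (auto intro: mult_nonpos_nonpos)
  thus ?thesis by (simp add: choose2_def)
qed

text \<open>
  In the base \<open>p = r * s\<close>, Ramanujan's \<open>f(r, s)\<close> is \<open>theta p r\<close>; integer exponents require \<open>p\<close>
  and \<open>r\<close> to be nonzero.
\<close>
definition theta_term :: "complex \<Rightarrow> complex \<Rightarrow> int \<Rightarrow> complex" where
  "theta_term p a n = p powi choose2 n * a powi n"

definition theta :: "complex \<Rightarrow> complex \<Rightarrow> complex" where
  "theta p a = (\<Sum>\<^sub>\<infinity>n\<in>UNIV. theta_term p a n)"

lemma theta_term_0 [simp]: "theta_term p a 0 = 1"
  by (simp add: theta_term_def)

lemma theta_term_add_1:
  assumes "p \<noteq> 0" "a \<noteq> 0"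
  shows "theta_term p a (n + 1) = a * theta_term p (a * p) n"
  using assms
  by (simp add: theta_term_def choose2_add power_int_add power_int_mult_distrib)

lemma theta_term_Suc:
  assumes "p \<noteq> 0" "a \<noteq> 0"
  shows "theta_term p a (n + 1) = a * p powi n * theta_term p a n"
  using assms by (simp add: theta_term_def choose2_add power_int_add)

lemma theta_term_minus:
  assumes "p \<noteq> 0" "a \<noteq> 0"
  shows "theta_term p a (- n) = theta_term p (p / a) n"
  using assms
  by (simp add: theta_term_def choose2_minus power_int_add power_int_divide_distrib
      power_int_minus field_simps)

lemma summable_norm_theta_term_nat:
  assumes "p \<noteq> 0" "a \<noteq> 0" "norm p < 1"
  shows "summable (\<lambda>n::nat. norm (theta_term p a (int n)))"
proof -
  \<comment> \<open>The ratio of consecutive terms is \<open>a * p ^ n\<close>, which tends to 0;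
    any bound below 1 serves the ratio test, here 1/2.\<close>
  have "(\<lambda>n. norm a * norm p ^ n) \<longlonglongrightarrow> norm a * 0"
    using assms by (intro tendsto_intros LIMSEQ_power_zero) auto
  hence "\<forall>\<^sub>F n in sequentially. norm a * norm p ^ n < 1 / 2"
    by (rule order_tendstoD) auto
  then obtain N where N: "\<And>n. n \<ge> N \<Longrightarrow> norm a * norm p ^ n < 1 / 2"
    by (auto simp: eventually_sequentially)
  show ?thesis
  proof (rule summable_ratio_test)
    fix n assume "n \<ge> N"
    have "theta_term p a (int (Suc n)) = a * p ^ n * theta_term p a (int n)"
      using theta_term_Suc[OF assms(1,2), of "int n"] by (simp add: add.commute)
    hence "norm (theta_term p a (int (Suc n))) = (norm a * norm p ^ n) * norm (theta_term p a (int n))"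
      by (simp add: norm_mult norm_power)
    also have "\<dots> \<le> 1 / 2 * norm (theta_term p a (int n))"
      using N[OF \<open>n \<ge> N\<close>] by (intro mult_right_mono) auto
    finally show "norm (norm (theta_term p a (int (Suc n)))) \<le> 1 / 2 * norm (norm (theta_term p a (int n)))"
      by simp
  qed auto
qed

text \<open>The negative half of the series is again a nonnegative half, with \<open>a\<close>
  replaced by \<open>p / a\<close>, so the one-sided ratio test covers both.\<close>

lemma theta_term_abs_summable:
  assumes "p \<noteq> 0" "a \<noteq> 0" "norm p < 1"
  shows "(\<lambda>n. norm (theta_term p a n)) summable_on UNIV"
proof -
  have 1: "(\<lambda>n. norm (theta_term p a n)) summable_on range int"
    using summable_norm_theta_term_nat[OF assms]
    by (subst summable_on_reindex) (auto simp: o_def intro!: norm_summable_imp_summable_on)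
  have inj: "inj (\<lambda>n. - int n)" by (auto simp: inj_def)
  have "p / a \<noteq> 0" using assms by simp
  hence 2: "(\<lambda>n. norm (theta_term p a n)) summable_on range (\<lambda>n. - int n)"
    using summable_norm_theta_term_nat[of p "p / a"] assms
    by (subst summable_on_reindex[OF inj])
       (auto simp: o_def theta_term_minus intro!: norm_summable_imp_summable_on)
  have "(UNIV :: int set) = range int \<union> range (\<lambda>n. - int n)"
    by (metis (no_types, lifting) UNIV_eq_I UnCI int_cases2 rangeI)
  thus ?thesis using summable_on_union[OF 1 2] by simp
qed

lemma has_sum_theta:
  assumes "p \<noteq> 0" "a \<noteq> 0" "norm p < 1"
  shows "(theta_term p a has_sum theta p a) UNIV"
  unfolding theta_def
  using abs_summable_summable[OF theta_term_abs_summable[OF assms]] by (rule has_sum_infsum)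

text \<open>The exponents of \<open>r\<close> and \<open>s\<close> are \<open>choose2 n + n\<close>
  and \<open>choose2 n\<close>, so a common power of \<open>r * s\<close> splits off and leaves
  \<open>r powi n\<close>.\<close>

lemma ramanujan_f_eq_theta:
  assumes "r \<noteq> 0" "s \<noteq> 0"
  shows "ramanujan_f r s = theta (r * s) r"
  unfolding ramanujan_f_def theta_def
proof (rule infsum_cong)
  fix n :: int
  have eq: "n * (n + 1) div 2 = choose2 n + n"
    using choose2_minus[of n] by (simp add: choose2_def algebra_simps)
  have nn: "choose2 n + n \<ge> 0" using choose2_nonneg[of "-n"] by (simp add: choose2_minus)
  show "r ^ nat (n * (n + 1) div 2) * s ^ nat (n * (n - 1) div 2) = theta_term (r * s) r n"
    unfolding eq unfolding choose2_def[symmetric] theta_term_def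
    using assms nn choose2_nonneg[of n]
    by (simp flip: power_int_nonneg_exp add: power_int_add power_int_mult_distrib)
qed

text \<open>This is the symmetry f(a, b) = f(b, a) with b = p/a, obtained from n -> -n.\<close>

lemma theta_reflect:
  assumes "p \<noteq> 0" "a \<noteq> 0"
  shows "theta p (p / a) = theta p a"
  unfolding theta_def
  by (rule infsum_reindex_bij_witness[where i = uminus and j = uminus])
     (use assms in \<open>auto simp: theta_term_minus\<close>)

section \<open>Products of two theta series\<close>

lemma has_sum_times:
  fixes f g :: "'a \<Rightarrow> complex"
  assumes "(f has_sum s) A" "(g has_sum t) B"
  shows "((\<lambda>(x, y). f x * g y) has_sum (s * t)) (A \<times> B)"
proof (rule has_sum_SigmaI)
  have f: "(\<lambda>x. norm (f x)) summable_on A" and g: "(\<lambda>x. norm (g x)) summable_on B"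
    using assms summable_on_iff_abs_summable_on_complex has_sum_imp_summable by blast+
  \<comment> \<open>Complex summability is absolute, so the product family is absolutely summable on
    \<open>A \<times> B\<close> and may be summed iteratively.\<close>
  have "(\<lambda>z. norm (case z of (x, y) \<Rightarrow> f x * g y)) summable_on (A \<times> B)"
    unfolding Infinite_Sum.abs_summable_on_Sigma_iff
    using f g by (auto simp: norm_mult infsum_cmult_right' infsum_nonneg
        intro!: summable_on_cmult_right summable_on_cmult_left)
  thus "(\<lambda>(x, y). f x * g y) summable_on (A \<times> B)"
    by (rule abs_summable_summable)
  show "((\<lambda>y. case (x, y) of (x, y) \<Rightarrow> f x * g y) has_sum f x * t) B" for x
    using has_sum_cmult_right[OF assms(2)] by simp
  show "((\<lambda>x. f x * t) has_sum s * t) A"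
    using has_sum_cmult_left[OF assms(1)] by simp
qed

lemma has_sum_theta_times:
  assumes "p \<noteq> 0" "a \<noteq> 0" "c \<noteq> 0" "norm p < 1"
  shows "((\<lambda>(m, n). theta_term p a m * theta_term p c n) has_sum (theta p a * theta p c)) UNIV"
  using has_sum_times[OF has_sum_theta has_sum_theta, of p a p c] assms by simp

text \<open>The cross terms \<open>u * v\<close> cancel: choose2(u+v) + choose2(u-v) = 2 choose2(u)
  + 2 choose2(v) + v. The leftover v puts the factor \<open>p\<close> into
  \<open>a * p / c\<close>.\<close>

lemma theta_term_times:
  assumes "p \<noteq> 0" "a \<noteq> 0" "c \<noteq> 0"
  shows "theta_term p a (u + v) * theta_term p c (u - v)
       = theta_term (p ^ 2) (a * c) u * theta_term (p ^ 2) (a * p / c) v"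
proof -
  have e: "choose2 (u - v) = choose2 u + choose2 v + v - u * v"
    using choose2_add[of u "- v"] by (simp add: choose2_minus)
  have "(p ^ 2) powi n = p powi n * p powi n" for n
    using assms by (simp add: power2_eq_square power_int_mult_distrib)
  thus ?thesis
    using assms unfolding theta_term_def e choose2_add
    by (simp add: power_int_add power_int_diff power_int_mult_distrib power_int_divide_distrib
        field_simps)
qed

text \<open>The pairs (m, n) are split by the parity of m + n. Even pairs are (u+v, u-v); odd pairs
  are (u+v+1, u-v), where the shift by 1 pulls out a factor \<open>a\<close> and turns
  \<open>a\<close> into \<open>a * p\<close>.\<close>

lemma theta_times:
  assumes "p \<noteq> 0" "a \<noteq> 0" "c \<noteq> 0" "norm p < 1"
  shows "theta p a * theta p c = theta (p ^ 2) (a * c) * theta (p ^ 2) (a * p / c)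
       + a * theta (p ^ 2) (a * c * p) * theta (p ^ 2) (a * p ^ 2 / c)"
proof -
  let ?h = "\<lambda>(m, n). theta_term p a m * theta_term p c n"
  have p2: "p ^ 2 \<noteq> 0" "norm (p ^ 2) < 1"
    using assms by (auto simp: norm_power power_less_one_iff)
  let ?E = "{(m, n). even (m + n)} :: (int \<times> int) set"
  have even: "(?h has_sum (theta (p ^ 2) (a * c) * theta (p ^ 2) (a * p / c))) ?E"
  proof -
    have "((\<lambda>(u, v). theta_term (p ^ 2) (a * c) u * theta_term (p ^ 2) (a * p / c) v)
            has_sum (theta (p ^ 2) (a * c) * theta (p ^ 2) (a * p / c))) UNIV"
      using assms p2 by (intro has_sum_theta_times) auto
    also have "?this \<longleftrightarrow> ?thesis"
    proof (rule has_sum_reindex_bij_witness[where j = "\<lambda>(u, v). (u + v, u - v)"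
          and i = "\<lambda>(m, n). ((m + n) div 2, (m - n) div 2)"], goal_cases)
      case (3 b)
      obtain m n where b: "b = (m, n)" by force
      with 3 have "even (m + n)" by simp
      then obtain k where "m + n = 2 * k" by (elim evenE)
      moreover from this have "m = 2 * k - n" by simp
      ultimately show ?case by (auto simp: b)
    next
      case (5 b)
      thus ?case using theta_term_times[OF assms(1-3)] by (auto split: prod.splits)
    qed auto
    finally show ?thesis .
  qed
  have odd: "(?h has_sum (a * (theta (p ^ 2) (a * c * p) * theta (p ^ 2) (a * p ^ 2 / c)))) (- ?E)"
  proof -
    have "((\<lambda>(u, v). theta_term (p ^ 2) (a * c * p) u * theta_term (p ^ 2) (a * p ^ 2 / c) v)
            has_sum (theta (p ^ 2) (a * c * p) * theta (p ^ 2) (a * p ^ 2 / c))) UNIV"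
      using assms p2 by (intro has_sum_theta_times) auto
    hence "((\<lambda>x. a * (case x of (u, v) \<Rightarrow> theta_term (p ^ 2) (a * c * p) u * theta_term (p ^ 2) (a * p ^ 2 / c) v))
            has_sum (a * (theta (p ^ 2) (a * c * p) * theta (p ^ 2) (a * p ^ 2 / c)))) UNIV"
      by (rule has_sum_cmult_right)
    also have "?this \<longleftrightarrow> ?thesis"
    proof (rule has_sum_reindex_bij_witness[where j = "\<lambda>(u, v). (u + v + 1, u - v)"
          and i = "\<lambda>(m, n). ((m + n - 1) div 2, (m - n - 1) div 2)"], goal_cases)
      case (3 b)
      obtain m n where b: "b = (m, n)" by force
      with 3 have "odd (m + n)" by simp
      then obtain k where "m + n = 2 * k + 1" by (elim oddE)
      moreover from this have "m = 2 * k + 1 - n" by simp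
      ultimately show ?case by (auto simp: b)
    next
      case (5 b)
      obtain u v where b: "b = (u, v)" by force
      show ?case
        using theta_term_times[of p "a * p" c u v] assms
        by (simp add: b theta_term_add_1 power2_eq_square mult_ac)
    qed auto
    finally show ?thesis .
  qed
  have "(?h has_sum (theta (p ^ 2) (a * c) * theta (p ^ 2) (a * p / c)
       + a * (theta (p ^ 2) (a * c * p) * theta (p ^ 2) (a * p ^ 2 / c)))) (?E \<union> - ?E)"
    by (rule has_sum_Un_disjoint[OF even odd]) auto
  moreover have "?E \<union> - ?E = UNIV" by auto
  ultimately show ?thesis
    using has_sum_unique[OF has_sum_theta_times[OF assms]] by (simp only: mult.assoc)
qed

text \<open>The substitution multiplies the quadratic form by 5 without cross terms: (u+2v)^2 +
  (2u-v)^2 = 5(u^2 + v^2). The offsets m0, n0 only affect the linear terms and the constant.\<close>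

lemma theta_term_times_quintic:
  assumes "q \<noteq> 0"
  shows "theta_term q 1 (m0 + u + 2 * v) * theta_term q 1 (n0 + 2 * u - v)
       = q powi (choose2 m0 + choose2 n0)
         * (theta_term (q ^ 5) (q powi (m0 + 2 * n0 + 1)) u
          * theta_term (q ^ 5) (q powi (2 * m0 - n0 + 2)) v)"
proof -
  have "10 * choose2 u = 5 * (u * (u - 1))" "10 * choose2 v = 5 * (v * (v - 1))"
    by (simp_all flip: two_choose2)
  hence "2 * (choose2 (m0 + u + 2 * v) + choose2 (n0 + 2 * u - v))
      = 2 * (choose2 m0 + choose2 n0 + (5 * choose2 u + (m0 + 2 * n0 + 1) * u
          + (5 * choose2 v + (2 * m0 - n0 + 2) * v)))"
    unfolding distrib_left two_choose2 by (simp add: algebra_simps)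
  hence e: "choose2 (m0 + u + 2 * v) + choose2 (n0 + 2 * u - v)
      = choose2 m0 + choose2 n0 + (5 * choose2 u + (m0 + 2 * n0 + 1) * u
          + (5 * choose2 v + (2 * m0 - n0 + 2) * v))" by simp
  have q5: "(q ^ 5) powi n = q powi (5 * n)" for n
    by (simp add: power_int_power)
  have "theta_term q 1 (m0 + u + 2 * v) * theta_term q 1 (n0 + 2 * u - v)
      = q powi (choose2 (m0 + u + 2 * v) + choose2 (n0 + 2 * u - v))"
    using assms by (simp add: theta_term_def power_int_add)
  also have "\<dots> = q powi (choose2 m0 + choose2 n0)
         * (theta_term (q ^ 5) (q powi (m0 + 2 * n0 + 1)) u
          * theta_term (q ^ 5) (q powi (2 * m0 - n0 + 2)) v)"
    unfolding e theta_term_def q5 power_int_mult[symmetric]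
    using assms by (simp only: power_int_add simp_thms disj_not1 mult.assoc)
  finally show ?thesis .
qed

lemma has_sum_theta_quintic_class:
  assumes "q \<noteq> 0" "norm q < 1"
  shows "((\<lambda>(m, n). theta_term q 1 m * theta_term q 1 n) has_sum
          q powi (choose2 m0 + choose2 n0) * (theta (q ^ 5) (q powi (m0 + 2 * n0 + 1))
            * theta (q ^ 5) (q powi (2 * m0 - n0 + 2))))
          {(m, n). 5 dvd ((m - m0) + 2 * (n - n0))}"
proof -
  have q5: "q ^ 5 \<noteq> 0" "norm (q ^ 5) < 1"
    using assms by (auto simp: norm_power power_less_one_iff)
  have "((\<lambda>(u, v). theta_term (q ^ 5) (q powi (m0 + 2 * n0 + 1)) u
            * theta_term (q ^ 5) (q powi (2 * m0 - n0 + 2)) v) has_sum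
          theta (q ^ 5) (q powi (m0 + 2 * n0 + 1))
            * theta (q ^ 5) (q powi (2 * m0 - n0 + 2))) UNIV"
    using assms q5 by (intro has_sum_theta_times) auto
  hence "((\<lambda>x. q powi (choose2 m0 + choose2 n0) * (case x of (u, v) \<Rightarrow>
             theta_term (q ^ 5) (q powi (m0 + 2 * n0 + 1)) u
            * theta_term (q ^ 5) (q powi (2 * m0 - n0 + 2)) v)) has_sum
          q powi (choose2 m0 + choose2 n0) * (theta (q ^ 5) (q powi (m0 + 2 * n0 + 1))
            * theta (q ^ 5) (q powi (2 * m0 - n0 + 2)))) UNIV"
    by (rule has_sum_cmult_right)
  also have "?this \<longleftrightarrow> ?thesis"
  proof (rule has_sum_reindex_bij_witness[
        where j = "\<lambda>(u, v). (m0 + u + 2 * v, n0 + 2 * u - v)"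
          and i = "\<lambda>(m, n). (((m - m0) + 2 * (n - n0)) div 5, (2 * (m - m0) - (n - n0)) div 5)"],
        goal_cases)
    case (1 b)
    obtain u v where "b = (u, v)" by force
    moreover have "u + 2 * v + 2 * (2 * u - v) = 5 * u" "2 * (u + 2 * v) - (2 * u - v) = 5 * v"
      by auto
    ultimately show ?case by (simp add: algebra_simps)
  next
    case (2 b)
    obtain u v where b: "b = (u, v)" by force
    have "m0 + u + 2 * v - m0 + 2 * (n0 + 2 * u - v - n0) = 5 * u" by simp
    thus ?case by (simp add: b)
  next
    case (3 b)
    obtain m n where b: "b = (m, n)" by force
    with 3 have "5 dvd ((m - m0) + 2 * (n - n0))" by simp
    then obtain k where k: "(m - m0) + 2 * (n - n0) = 5 * k" by (elim dvdE)
    hence m: "m = m0 + 5 * k - 2 * (n - n0)" by simp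
    \<comment> \<open>One divisibility suffices for both coordinates: modulo 5, 2(m-m0) - (n-n0) is
      twice (m-m0) + 2(n-n0).\<close>
    have "2 * (m - m0) - (n - n0) = 5 * (2 * k - (n - n0))" by (simp add: m)
    thus ?case using k unfolding b by (simp add: m)
  next
    case (5 b)
    thus ?case using theta_term_times_quintic[OF assms(1), of m0 _ _ n0]
      by (auto split: prod.splits)
  qed auto
  finally show ?thesis .
qed

text \<open>
  The double series is split over the five cosets in \<open>\<int>[\<i>]\<close> of the ideal generated by
  \<open>2 + \<i>\<close>, on which the norm form is multiplied by \<open>5\<close>.
\<close>
lemma theta_one_square:
  assumes "q \<noteq> 0" "norm q < 1"
  shows "theta q 1 ^ 2 = q * theta (q ^ 5) 1 ^ 2 + 4 * (theta (q ^ 5) q * theta (q ^ 5) (q ^ 2))"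
proof -
  \<comment> \<open>These representatives realise the residues 0, 1, 2, 3, 4 of m + 2n modulo 5, and
    only the last has \<open>choose2 m0 + choose2 n0\<close> different from 0.\<close>
  define I where "I = {(0, 0), (1, 0), (0, 1), (1, 1), (0, 2) :: int \<times> int}"
  define B where "B = (\<lambda>(m0, n0). {(m, n). (m + 2 * n) mod 5 = (m0 + 2 * n0) mod (5::int)})"
  define s where "s = (\<lambda>(m0, n0). q powi (choose2 m0 + choose2 n0)
     * (theta (q ^ 5) (q powi (m0 + 2 * n0 + 1)) * theta (q ^ 5) (q powi (2 * m0 - n0 + 2))))"
  have "((\<lambda>(m, n). theta_term q 1 m * theta_term q 1 n) has_sum sum s I) (\<Union>i\<in>I. B i)"
  proof (rule sum_has_sum)
    show "B i \<inter> B j = {}" if "i \<in> I" "j \<in> I" "i \<noteq> j" for i j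
      using that unfolding I_def B_def by auto
    show "((\<lambda>(m, n). theta_term q 1 m * theta_term q 1 n) has_sum s i) (B i)" for i
    proof -
      obtain m0 n0 where i: "i = (m0, n0)" by force
      have "B i = {(m, n). 5 dvd ((m - m0) + 2 * (n - n0))}"
        by (auto simp: i B_def mod_eq_dvd_iff algebra_simps)
      thus ?thesis using has_sum_theta_quintic_class[OF assms, of m0 n0] by (simp add: i s_def)
    qed
  qed (simp add: I_def)
  moreover have "(\<Union>i\<in>I. B i) = UNIV"
  proof -
    have "x \<in> (\<Union>i\<in>I. B i)" for x
    proof -
      obtain m n where x: "x = (m, n)" by force
      have "0 \<le> (m + 2 * n) mod 5" "(m + 2 * n) mod 5 < 5" by simp_all
      hence "(m + 2 * n) mod 5 \<in> {0, 1, 2, 3, 4}" by (simp only: insert_iff empty_iff) linarith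
      thus ?thesis by (simp add: I_def B_def x)
    qed
    thus ?thesis by blast
  qed
  ultimately have "theta q 1 * theta q 1 = sum s I"
    using has_sum_theta_times[of q 1 1] assms has_sum_unique by fastforce
  \<comment> \<open>After reflection the first four classes contribute the same product, which gives
    the coefficient 4; the class of (0, 2) contributes
    \<open>q * theta (q ^ 5) 1 ^ 2\<close>.\<close>
  moreover have "theta (q ^ 5) (q ^ 5) = theta (q ^ 5) 1" "theta (q ^ 5) (q ^ 3) = theta (q ^ 5) (q ^ 2)"
    "theta (q ^ 5) (q ^ 4) = theta (q ^ 5) q"
    using theta_reflect[of "q ^ 5" 1] theta_reflect[of "q ^ 5" "q ^ 2"] theta_reflect[of "q ^ 5" "q ^ 4"] assms
    by (simp_all flip: power_diff)
  ultimately show ?thesis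
    by (simp add: I_def s_def power2_eq_square mult_ac)
qed

section \<open>The Jacobi triple product\<close>

definition qpoch_inf :: "complex \<Rightarrow> complex \<Rightarrow> complex" where
  "qpoch_inf a p = (\<Prod>n. 1 - a * p ^ n)"

lemma convergent_prod_qpoch:
  assumes "norm p < 1"
  shows "convergent_prod (\<lambda>n. 1 - a * p ^ n :: complex)"
proof (rule abs_convergent_prod_imp_convergent_prod)
  have "summable (\<lambda>n. norm a * norm p ^ n)"
    using assms by (intro summable_mult summable_geometric) auto
  thus "abs_convergent_prod (\<lambda>n. 1 - a * p ^ n)"
    by (simp add: abs_convergent_prod_conv_summable norm_mult norm_power)
qed

lemma qpoch_LIMSEQ:
  assumes "norm p < 1"
  shows "(\<lambda>n. \<Prod>k<n. 1 - a * p ^ k) \<longlonglongrightarrow> qpoch_inf a p"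
proof -
  have "(\<lambda>n. \<Prod>k<Suc n. 1 - a * p ^ k) \<longlonglongrightarrow> qpoch_inf a p"
    unfolding qpoch_inf_def lessThan_Suc_atMost
    by (rule convergent_prod_LIMSEQ[OF convergent_prod_qpoch[OF assms]])
  thus ?thesis by (rule LIMSEQ_imp_Suc)
qed

lemma qpoch_factor_nonzero:
  assumes "norm a < 1" "norm p < 1"
  shows "1 - a * p ^ n \<noteq> (0 :: complex)"
proof
  assume "1 - a * p ^ n = 0"
  hence "norm a * norm p ^ n = 1" by (metis eq_iff_diff_eq_0 norm_mult norm_one norm_power)
  moreover have "norm a * norm p ^ n \<le> norm a * 1"
    using assms by (intro mult_left_mono power_le_one) auto
  ultimately show False using assms by simp
qed

lemma qpoch_inf_nonzero:
  assumes "norm a < 1" "norm p < 1"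
  shows "qpoch_inf a p \<noteq> 0"
  unfolding qpoch_inf_def
  using prodinf_nonzero[OF convergent_prod_qpoch[OF assms(2)]] qpoch_factor_nonzero[OF assms] by blast

text \<open>Factors are grouped by the residue of their index modulo \<open>m\<close>. The
  regrouping is done on the finite products of length \<open>n * m\<close>, a subsequence of the
  partial products.\<close>

lemma qpoch_inf_dissect:
  assumes "norm p < 1" "m > 0"
  shows "qpoch_inf a p = (\<Prod>i<m. qpoch_inf (a * p ^ i) (p ^ m))"
proof (rule LIMSEQ_unique)
  have pm: "norm (p ^ m) < 1" using assms by (auto simp: norm_power power_less_one_iff)
  show "(\<lambda>n. \<Prod>i<m. \<Prod>k<n. 1 - a * p ^ i * (p ^ m) ^ k) \<longlonglongrightarrow> (\<Prod>i<m. qpoch_inf (a * p ^ i) (p ^ m))"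
    by (intro tendsto_prod qpoch_LIMSEQ pm)
  have "strict_mono (\<lambda>n. n * m)" using assms by (simp add: strict_mono_def)
  from LIMSEQ_subseq_LIMSEQ[OF qpoch_LIMSEQ[OF assms(1)] this]
  have "(\<lambda>n. \<Prod>k<n * m. 1 - a * p ^ k) \<longlonglongrightarrow> qpoch_inf a p" by (simp add: o_def)
  also have "(\<lambda>n. \<Prod>k<n * m. 1 - a * p ^ k) = (\<lambda>n. \<Prod>i<m. \<Prod>k<n. 1 - a * p ^ i * (p ^ m) ^ k)"
  proof
    fix n
    have "(\<Prod>k<n * m. 1 - a * p ^ k) = (\<Prod>k<n. \<Prod>j\<in>{k * m..<k * m + m}. 1 - a * p ^ j)"
      by (rule prod.nat_group[symmetric])
    also have "\<dots> = (\<Prod>k<n. \<Prod>i<m. 1 - a * p ^ (k * m + i))"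
    proof (rule prod.cong[OF refl])
      fix k
      show "(\<Prod>j\<in>{k * m..<k * m + m}. 1 - a * p ^ j) = (\<Prod>i<m. 1 - a * p ^ (k * m + i))"
        by (rule prod.reindex_bij_witness[where i = "\<lambda>i. k * m + i" and j = "\<lambda>j. j - k * m"]) auto
    qed
    also have "\<dots> = (\<Prod>i<m. \<Prod>k<n. 1 - a * p ^ (k * m + i))"
      by (rule prod.swap)
    finally show "(\<Prod>k<n * m. 1 - a * p ^ k) = (\<Prod>i<m. \<Prod>k<n. 1 - a * p ^ i * (p ^ m) ^ k)"
      by (simp add: power_add power_mult[symmetric] mult_ac)
  qed
  finally show "(\<lambda>n. \<Prod>i<m. \<Prod>k<n. 1 - a * p ^ i * (p ^ m) ^ k) \<longlonglongrightarrow> qpoch_inf a p" .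
qed

lemma qpoch_inf_times_uminus:
  assumes "norm p < 1"
  shows "qpoch_inf a p * qpoch_inf (- a) p = qpoch_inf (a ^ 2) (p ^ 2)"
  unfolding qpoch_inf_def prodinf_mult[OF convergent_prod_qpoch convergent_prod_qpoch, OF assms assms]
  by (rule prodinf_cong)
     (simp add: algebra_simps power_mult_distrib power2_eq_square power_mult[symmetric])

lemma qpoch_inf_head:
  assumes "norm p < 1"
  shows "qpoch_inf a p = (1 - a) * qpoch_inf (a * p) p"
proof (rule LIMSEQ_unique)
  show "(\<lambda>n. (1 - a) * (\<Prod>k<n. 1 - a * p * p ^ k)) \<longlonglongrightarrow> (1 - a) * qpoch_inf (a * p) p"
    by (intro tendsto_intros qpoch_LIMSEQ assms)
  have "(\<Prod>k<Suc n. 1 - a * p ^ k) = (1 - a) * (\<Prod>k<n. 1 - a * p * p ^ k)" for n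
    by (subst prod.lessThan_Suc_shift) (simp add: mult_ac)
  thus "(\<lambda>n. (1 - a) * (\<Prod>k<n. 1 - a * p * p ^ k)) \<longlonglongrightarrow> qpoch_inf a p"
    using LIMSEQ_Suc[OF qpoch_LIMSEQ[OF assms, of a]] by simp
qed

section \<open>Finite form of the triple product\<close>

definition qfact :: "complex \<Rightarrow> nat \<Rightarrow> complex" where
  "qfact p n = (\<Prod>k<n. 1 - p * p ^ k)"

text \<open>
  Reciprocal of the \<open>q\<close>-factorial, extended by \<open>0\<close> to negative arguments so that the recurrence
  \<open>rqfact p (j - 1) = (1 - p\<^sup>j) * rqfact p j\<close> holds for all integers \<open>j\<close>.
\<close>
definition rqfact :: "complex \<Rightarrow> int \<Rightarrow> complex" where
  "rqfact p j = (if j < 0 then 0 else inverse (qfact p (nat j)))"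

lemma qfact_nonzero: "norm p < 1 \<Longrightarrow> qfact p n \<noteq> 0"
  unfolding qfact_def using qpoch_factor_nonzero[of p p] by (simp add: prod_zero_iff)

lemma rqfact_rec:
  assumes "norm p < 1" "p \<noteq> 0"
  shows "rqfact p (j - 1) = (1 - p powi j) * rqfact p j"
proof (cases "j \<ge> 1")
  case True
  obtain n where j: "j = int (Suc n)"
    by (rule that[of "nat (j - 1)"]) (use True in auto)
  have "rqfact p j = inverse (qfact p n * (1 - p ^ Suc n))"
    by (simp add: rqfact_def j nat_add_distrib qfact_def)
  moreover have "1 - p ^ Suc n \<noteq> 0"
    using qpoch_factor_nonzero[of p p n] assms by simp
  moreover have "rqfact p (j - 1) = inverse (qfact p n)"
    by (simp add: rqfact_def j)
  moreover have "p powi j = p ^ Suc n" unfolding j by (rule power_int_of_nat)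
  ultimately show ?thesis by simp
next
  case False
  \<comment> \<open>At j = 0 the factor \<open>1 - p powi 0\<close> vanishes, which matches the
    default value \<open>rqfact p (-1) = 0\<close>.\<close>
  hence "j < 0 \<or> j = 0" by linarith
  thus ?thesis by (auto simp: rqfact_def)
qed

lemma qfact_LIMSEQ: "norm p < 1 \<Longrightarrow> qfact p \<longlonglongrightarrow> qpoch_inf p p"
  using qpoch_LIMSEQ[of p p] by (simp add: qfact_def[abs_def])

lemma rqfact_LIMSEQ:
  assumes "norm p < 1"
  shows "(\<lambda>n. rqfact p (int n + k)) \<longlonglongrightarrow> inverse (qpoch_inf p p)"
proof -
  have "filterlim (\<lambda>n. nat (int n + k)) at_top sequentially"
    unfolding filterlim_at_top eventually_sequentially
  proof
    fix Z show "\<exists>N. \<forall>n\<ge>N. Z \<le> nat (int n + k)"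
      by (intro exI[of _ "nat (int Z - k)"]) auto
  qed
  from filterlim_compose[OF tendsto_inverse[OF qfact_LIMSEQ[OF assms]] this]
  have "(\<lambda>n. inverse (qfact p (nat (int n + k)))) \<longlonglongrightarrow> inverse (qpoch_inf p p)"
    using qpoch_inf_nonzero[OF assms assms] by auto
  moreover have "\<forall>\<^sub>F n in sequentially. inverse (qfact p (nat (int n + k))) = rqfact p (int n + k)"
    unfolding eventually_sequentially rqfact_def by (intro exI[of _ "nat (- k)"]) auto
  ultimately show ?thesis by (rule Lim_transform_eventually)
qed

text \<open>The bound is uniform in \<open>j\<close>: the values converge along nonnegative
  \<open>j\<close> and are 0 elsewhere. It yields the dominating series in
  \<open>jacobi_triple_product\<close>.\<close>

lemma rqfact_bounded:
  assumes "norm p < 1"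
  obtains K where "K > 0" "\<And>j. norm (rqfact p j) \<le> K"
proof -
  have "Bseq (\<lambda>n. rqfact p (int n + 0))"
    by (rule convergent_imp_Bseq) (use rqfact_LIMSEQ[OF assms, of 0] convergent_def in blast)
  then obtain K where K: "K > 0" "\<And>n. norm (rqfact p (int n)) \<le> K"
    by (auto simp: Bseq_def)
  have "norm (rqfact p j) \<le> K" for j
  proof (cases "j < 0")
    case False
    thus ?thesis using K(2)[of "nat j"] by simp
  qed (use K(1) in \<open>auto simp: rqfact_def\<close>)
  with K(1) show ?thesis by (rule that)
qed

text \<open>This is the Gaussian binomial coefficient of 2n over n + k in base \<open>p\<close>; it
  vanishes for |k| > n by the convention for \<open>rqfact\<close>.\<close>

definition triple_coeff :: "complex \<Rightarrow> nat \<Rightarrow> int \<Rightarrow> complex" where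
  "triple_coeff p n k = qfact p (2 * n) * rqfact p (int n + k) * rqfact p (int n - k)"

text \<open>The three terms mirror (1 + a p^n)(1 + p^(n+1)/a) = (1 + p^(2n+1)) + a p^n + p^(n+1)/a,
  the factor gained from n to n + 1.\<close>

lemma triple_coeff_rec:
  assumes "norm p < 1" "p \<noteq> 0"
  shows "triple_coeff p (Suc n) k = (1 + p ^ (2 * n + 1)) * triple_coeff p n k
       + p powi (int n - k + 1) * triple_coeff p n (k - 1)
       + p powi (int n + k + 1) * triple_coeff p n (k + 1)"
proof -
  \<comment> \<open>All powers are expressed through \<open>x\<close>, \<open>y\<close>,
    \<open>p\<close> and all reciprocal factorials through \<open>R\<close>, \<open>S\<close>; what
    remains is a rational identity.\<close>
  define x y where "x = p powi (int n + k + 1)" and "y = p powi (int n - k + 1)"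
  define R S where "R = rqfact p (int n + k + 1)" and "S = rqfact p (int n - k + 1)"
  have px: "p powi (int n + k) = x / p" and py: "p powi (int n - k) = y / p"
    using assms by (simp_all add: x_def y_def power_int_add)
  have xy: "p ^ (2 * n + 1) = x * y / p" 
  proof -
    have "x * y = p powi (int n + k + 1 + (int n - k + 1))"
      using assms unfolding x_def y_def by (subst power_int_add) auto
    also have "int n + k + 1 + (int n - k + 1) = int (2 * n + 2)" by simp
    finally show ?thesis using assms by (simp only: power_int_of_nat) simp
  qed
  have R1: "rqfact p (int n + k) = (1 - x) * R" and S1: "rqfact p (int n - k) = (1 - y) * S"
    using rqfact_rec[OF assms, of "int n + k + 1"] rqfact_rec[OF assms, of "int n - k + 1"]
    by (simp_all add: x_def y_def R_def S_def)
  have R2: "rqfact p (int n + (k - 1)) = (1 - x / p) * (1 - x) * R"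
    and S2: "rqfact p (int n - (k + 1)) = (1 - y / p) * (1 - y) * S"
    using rqfact_rec[OF assms, of "int n + k"] rqfact_rec[OF assms, of "int n - k"]
    by (simp_all only: px py R1 S1 add_diff_eq diff_diff_add mult.assoc)
  have Q: "qfact p (2 * Suc n) = qfact p (2 * n) * (1 - x * y / p) * (1 - x * y)"
  proof -
    have "p ^ (2 * n + 2) = x * y" using xy assms by (simp add: field_simps)
    thus ?thesis unfolding xy[symmetric] by (simp add: qfact_def)
  qed
  have "rqfact p (int (Suc n) + k) = R" "rqfact p (int (Suc n) - k) = S"
    "rqfact p (int n - (k - 1)) = S" "rqfact p (int n + (k + 1)) = R"
    by (simp_all add: R_def S_def algebra_simps)
  note defs = this R1 S1 R2 S2 Q xy x_def[symmetric] y_def[symmetric]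
  show ?thesis unfolding triple_coeff_def defs
    using assms by (simp add: field_simps)
qed

lemma finite_triple_product:
  assumes "norm p < 1" "p \<noteq> 0" "a \<noteq> 0"
  shows "((\<lambda>k. triple_coeff p n k * theta_term p a k) has_sum
           (\<Prod>j<n. (1 + a * p ^ j) * (1 + p / a * p ^ j))) UNIV"
proof (induction n)
  case 0
  have "triple_coeff p 0 k * theta_term p a k = 0" if "k \<noteq> 0" for k
    using that by (auto simp: triple_coeff_def rqfact_def)
  moreover have "triple_coeff p 0 0 = 1" by (simp add: triple_coeff_def rqfact_def qfact_def)
  ultimately have "((\<lambda>k. triple_coeff p 0 k * theta_term p a k) has_sum 1) {0}
     \<longleftrightarrow> ((\<lambda>k. triple_coeff p 0 k * theta_term p a k) has_sum 1) UNIV"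
    by (intro has_sum_cong_neutral) auto
  moreover have "((\<lambda>k. triple_coeff p 0 k * theta_term p a k) has_sum 1) {0}"
    using \<open>triple_coeff p 0 0 = 1\<close> by (intro has_sum_finiteI) auto
  ultimately show ?case by simp
next
  case (Suc n)
  define G where "G = (\<Prod>j<n. (1 + a * p ^ j) * (1 + p / a * p ^ j))"
  define g where "g = (\<lambda>k. triple_coeff p n k * theta_term p a k)"
  have g: "(g has_sum G) UNIV" using Suc unfolding g_def G_def .
  have g1: "((\<lambda>k. g (k - 1)) has_sum G) UNIV"
    using g by (subst has_sum_reindex_bij_witness[where j = "\<lambda>k. k - 1" and i = "\<lambda>k. k + 1" and h = g and T = UNIV])
      auto
  have g2: "((\<lambda>k. g (k + 1)) has_sum G) UNIV"
    using g by (subst has_sum_reindex_bij_witness[where i = "\<lambda>k. k - 1" and j = "\<lambda>k. k + 1" and h = g and T = UNIV])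
      auto
  have "((\<lambda>k. (1 + p ^ (2 * n + 1)) * g k + a * p ^ n * g (k - 1) + p / a * p ^ n * g (k + 1))
     has_sum ((1 + p ^ (2 * n + 1)) * G + a * p ^ n * G + p / a * p ^ n * G)) UNIV"
    by (intro has_sum_add has_sum_cmult_right g g1 g2)
  moreover have "(1 + p ^ (2 * n + 1)) * G + a * p ^ n * G + p / a * p ^ n * G
     = (\<Prod>j<Suc n. (1 + a * p ^ j) * (1 + p / a * p ^ j))"
    unfolding prod.lessThan_Suc G_def[symmetric]
    using assms by (simp add: field_simps mult_2_right power_add)
  moreover have "(1 + p ^ (2 * n + 1)) * g k + a * p ^ n * g (k - 1) + p / a * p ^ n * g (k + 1)
     = triple_coeff p (Suc n) k * theta_term p a k" for k
  proof -
    \<comment> \<open>The ratio of consecutive theta terms brings both shifted terms back to index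
      \<open>k\<close>, producing the powers of \<open>p\<close> in
      \<open>triple_coeff_rec\<close>.\<close>
    have "theta_term p a k = a * p powi (k - 1) * theta_term p a (k - 1)"
      using theta_term_Suc[OF assms(2,3), of "k - 1"] by simp
    hence 1: "a * p ^ n * theta_term p a (k - 1) = p powi (int n - k + 1) * theta_term p a k"
      using assms by (simp add: power_int_add power_int_diff field_simps)
    have 2: "p / a * p ^ n * theta_term p a (k + 1) = p powi (int n + k + 1) * theta_term p a k"
      using assms by (simp add: theta_term_Suc power_int_add)
    have "(1 + p ^ (2 * n + 1)) * g k + a * p ^ n * g (k - 1) + p / a * p ^ n * g (k + 1)
      = (1 + p ^ (2 * n + 1)) * triple_coeff p n k * theta_term p a k
       + triple_coeff p n (k - 1) * (a * p ^ n * theta_term p a (k - 1))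
       + triple_coeff p n (k + 1) * (p / a * p ^ n * theta_term p a (k + 1))"
      by (simp add: g_def algebra_simps)
    also have "\<dots> = triple_coeff p (Suc n) k * theta_term p a k"
      unfolding 1 2 triple_coeff_rec[OF assms(1,2)] by (simp add: algebra_simps)
    finally show ?thesis .
  qed
  ultimately show ?case by simp
qed

text \<open>Let n tend to infinity in \<open>finite_triple_product\<close>: each coefficient tends
  to 1/(p; p)_inf, and Tannery's theorem exchanges limit and sum.\<close>

theorem jacobi_triple_product:
  assumes "norm p < 1" "p \<noteq> 0" "a \<noteq> 0"
  shows "theta p a = qpoch_inf (- a) p * qpoch_inf (- p / a) p * qpoch_inf p p"
proof -
  \<comment> \<open>Enumerating the integers by \<open>int_decode\<close> turns the bilateral series
    into ordinary ones, the setting of Tannery's theorem.\<close>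
  define t where "t = (\<lambda>i. theta_term p a (int_decode i))"
  define c where "c = (\<lambda>n i. triple_coeff p n (int_decode i))"
  define P where "P = qpoch_inf p p"
  have P: "P \<noteq> 0" unfolding P_def using assms by (intro qpoch_inf_nonzero)
  have t: "summable (\<lambda>i. norm (t i))"
  proof -
    have "(\<lambda>i. norm (t i)) summable_on UNIV"
      using theta_term_abs_summable[OF assms(2,3,1)]
      unfolding t_def by (subst summable_on_reindex_bij_betw[OF bij_int_decode, of "\<lambda>k. norm (theta_term p a k)"])
    thus ?thesis by (rule summable_on_imp_summable)
  qed
  have theta: "t sums theta p a"
    using has_sum_theta[OF assms(2,3,1)] has_sum_reindex_bij_betw[OF bij_int_decode, of "theta_term p a"]
    unfolding t_def by (intro has_sum_imp_sums) auto
  have fin: "(\<lambda>i. c n i * t i) sums (\<Prod>j<n. (1 + a * p ^ j) * (1 + p / a * p ^ j))" for n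
    using finite_triple_product[OF assms, of n]
      has_sum_reindex_bij_betw[OF bij_int_decode, of "\<lambda>k. triple_coeff p n k * theta_term p a k"]
    unfolding t_def c_def by (intro has_sum_imp_sums) auto
  have lim_c: "(\<lambda>n. c n i) \<longlonglongrightarrow> inverse P" for i
  proof -
    have "strict_mono (\<lambda>n::nat. 2 * n)" by (simp add: strict_mono_def)
    hence "(\<lambda>n. qfact p (2 * n)) \<longlonglongrightarrow> P"
      using LIMSEQ_subseq_LIMSEQ[OF qfact_LIMSEQ[OF assms(1)]] by (simp add: o_def P_def)
    hence "(\<lambda>n. c n i) \<longlonglongrightarrow> P * inverse P * inverse P"
      using rqfact_LIMSEQ[OF assms(1), of "int_decode i"] rqfact_LIMSEQ[OF assms(1), of "- int_decode i"]
      unfolding c_def triple_coeff_def P_def by (intro tendsto_mult) auto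
    thus ?thesis using P by simp
  qed
  obtain K where K: "\<And>n i. norm (c n i) \<le> K"
  proof -
    obtain K1 where K1: "K1 > 0" "\<And>j. norm (rqfact p j) \<le> K1"
      using rqfact_bounded[OF assms(1)] by blast
    have "Bseq (qfact p)"
      by (rule convergent_imp_Bseq) (use qfact_LIMSEQ[OF assms(1)] convergent_def in blast)
    then obtain K2 where K2: "K2 > 0" "\<And>n. norm (qfact p n) \<le> K2" by (auto simp: Bseq_def)
    have "norm (c n i) \<le> K2 * K1 * K1" for n i
      unfolding c_def triple_coeff_def norm_mult using K1 K2
      by (intro mult_mono) (auto intro: mult_nonneg_nonneg less_imp_le)
    thus ?thesis by (rule that)
  qed
  have "(\<lambda>n. \<Sum>i. c n i * t i) \<longlonglongrightarrow> (\<Sum>i. inverse P * t i)"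
  proof (rule tannerys_theorem[THEN conjunct2, THEN conjunct2, of _ _ _ "\<lambda>i. K * norm (t i)"])
    show "(\<lambda>n. c n i * t i) \<longlonglongrightarrow> inverse P * t i" for i
      by (intro tendsto_intros lim_c)
    show "\<forall>\<^sub>F (i, n) in at_top \<times>\<^sub>F sequentially. norm (c n i * t i) \<le> K * norm (t i)"
      by (rule always_eventually) (auto simp: norm_mult K intro: mult_right_mono)
  qed (use t in \<open>auto intro: summable_mult\<close>)
  hence "(\<lambda>n. \<Prod>j<n. (1 + a * p ^ j) * (1 + p / a * p ^ j)) \<longlonglongrightarrow> inverse P * theta p a"
    using sums_unique[OF fin] sums_unique[OF sums_mult[OF theta, of "inverse P"]] by simp
  moreover have "(\<lambda>n. \<Prod>j<n. (1 + a * p ^ j) * (1 + p / a * p ^ j))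
      \<longlonglongrightarrow> qpoch_inf (- a) p * qpoch_inf (- p / a) p"
    using tendsto_mult[OF qpoch_LIMSEQ[OF assms(1), of "- a"] qpoch_LIMSEQ[OF assms(1), of "- p / a"]]
    by (simp add: prod.distrib)
  ultimately have "inverse P * theta p a = qpoch_inf (- a) p * qpoch_inf (- p / a) p"
    using LIMSEQ_unique by blast
  thus ?thesis using P by (simp add: P_def field_simps)
qed

section \<open>Product formulas\<close>

lemma norm_power_less_one:
  fixes q :: complex
  assumes "norm q < 1" "n > 0"
  shows "norm (q ^ n) < 1"
  using assms by (simp add: norm_power power_less_one_iff)

lemma qpoch_inf_even_odd:
  assumes "norm x < 1"
  shows "qpoch_inf a x = qpoch_inf a (x ^ 2) * qpoch_inf (a * x) (x ^ 2)"
  using qpoch_inf_dissect[OF assms, of 2 a] by (simp add: lessThan_Suc numeral_2_eq_2)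

text \<open>In base x^4 the triple product has the parameters -x and -x^3, which together run
  through all odd powers and merge into base x^2.\<close>

lemma ramanujan_psi_product:
  assumes "x \<noteq> 0" "norm x < 1"
  shows "ramanujan_psi x = qpoch_inf (- x) (x ^ 2) * qpoch_inf (x ^ 4) (x ^ 4)"
proof -
  have "ramanujan_psi x = theta (x ^ 4) x"
    using assms by (simp add: ramanujan_psi_def ramanujan_f_eq_theta flip: power_Suc)
  also have "\<dots> = qpoch_inf (- x) (x ^ 4) * qpoch_inf (- (x ^ 4) / x) (x ^ 4) * qpoch_inf (x ^ 4) (x ^ 4)"
    using assms by (intro jacobi_triple_product norm_power_less_one) auto
  also have "- (x ^ 4) / x = - (x ^ 3)"
    using assms by (simp add: power_numeral_reduce)
  also have "qpoch_inf (- x) (x ^ 4) * qpoch_inf (- (x ^ 3)) (x ^ 4) = qpoch_inf (- x) (x ^ 2)"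
    using assms qpoch_inf_even_odd[of "x ^ 2" "- x"]
    by (simp add: norm_power_less_one flip: power_Suc)
  finally show ?thesis .
qed

lemma ramanujan_phi_uminus_product:
  assumes "x \<noteq> 0" "norm x < 1"
  shows "ramanujan_phi (- x) = qpoch_inf x (x ^ 2) ^ 2 * qpoch_inf (x ^ 2) (x ^ 2)"
proof -
  have "ramanujan_phi (- x) = theta (x ^ 2) (- x)"
    using assms by (simp add: ramanujan_phi_def ramanujan_f_eq_theta power2_eq_square)
  also have "\<dots> = qpoch_inf (- (- x)) (x ^ 2) * qpoch_inf (- (x ^ 2) / (- x)) (x ^ 2) * qpoch_inf (x ^ 2) (x ^ 2)"
    using assms by (intro jacobi_triple_product norm_power_less_one) auto
  also have "- (x ^ 2) / (- x) = x" using assms by (simp add: power2_eq_square)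
  finally show ?thesis by (simp add: power2_eq_square)
qed

lemma ramanujan_psi_nonzero:
  assumes "x \<noteq> 0" "norm x < 1"
  shows "ramanujan_psi x \<noteq> 0"
  unfolding ramanujan_psi_product[OF assms]
  using assms by (simp add: qpoch_inf_nonzero norm_power_less_one)

lemma ramanujan_phi_uminus_nonzero:
  assumes "x \<noteq> 0" "norm x < 1"
  shows "ramanujan_phi (- x) \<noteq> 0"
  unfolding ramanujan_phi_uminus_product[OF assms]
  using assms by (simp add: qpoch_inf_nonzero norm_power_less_one)

text \<open>The 2 is the leading factor 1 - (-1) of (-1; x)_inf; the remaining factors regroup to
  the product for psi by (a; p)(-a; p) = (a^2; p^2) and even-odd splitting.\<close>

lemma theta_one_eq_psi:
  assumes "x \<noteq> 0" "norm x < 1"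
  shows "theta x 1 = 2 * ramanujan_psi x"
proof -
  have "theta x 1 = qpoch_inf (- 1) x * qpoch_inf (- x / 1) x * qpoch_inf x x"
    using assms by (intro jacobi_triple_product) auto
  also have "qpoch_inf (- 1) x = 2 * qpoch_inf (- x) x"
    using qpoch_inf_head[of x "- 1"] assms by simp
  also have "2 * qpoch_inf (- x) x * qpoch_inf (- x / 1) x * qpoch_inf x x
    = 2 * qpoch_inf (- x) x * (qpoch_inf x x * qpoch_inf (- x) x)" by simp
  also have "qpoch_inf x x * qpoch_inf (- x) x = qpoch_inf (x ^ 2) (x ^ 2)"
    using assms by (intro qpoch_inf_times_uminus)
  also have "qpoch_inf (- x) x = qpoch_inf (- x) (x ^ 2) * qpoch_inf (- (x ^ 2)) (x ^ 2)"
    using qpoch_inf_even_odd[of x "- x"] assms by (simp add: power2_eq_square)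
  also have "2 * (qpoch_inf (- x) (x ^ 2) * qpoch_inf (- (x ^ 2)) (x ^ 2)) * qpoch_inf (x ^ 2) (x ^ 2)
    = 2 * (qpoch_inf (- x) (x ^ 2) * (qpoch_inf (x ^ 2) (x ^ 2) * qpoch_inf (- (x ^ 2)) (x ^ 2)))"
    by simp
  also have "qpoch_inf (x ^ 2) (x ^ 2) * qpoch_inf (- (x ^ 2)) (x ^ 2) = qpoch_inf (x ^ 4) (x ^ 4)"
    using qpoch_inf_times_uminus[of "x ^ 2" "x ^ 2"] assms by (simp add: norm_power_less_one)
  finally show ?thesis by (simp add: ramanujan_psi_product assms)
qed

text \<open>It trades the square psi^2(-q^5) for a product of two theta functions of nome q^10, so
  that \<open>theta_times\<close> applies. In products, only one of the two factors (x^4; x^4)_inf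
  has to be split.\<close>

lemma ramanujan_psi_uminus_square:
  assumes "x \<noteq> 0" "norm x < 1"
  shows "ramanujan_psi (- x) ^ 2 = ramanujan_phi (- x) * ramanujan_psi (x ^ 2)"
proof -
  have n: "norm (x ^ 2) < 1" "norm (x ^ 4) < 1" using assms by (auto intro: norm_power_less_one)
  have 1: "qpoch_inf (x ^ 8) (x ^ 8) = qpoch_inf (x ^ 4) (x ^ 4) * qpoch_inf (- (x ^ 4)) (x ^ 4)"
    using qpoch_inf_times_uminus[OF n(2), of "x ^ 4"] by simp
  have 2: "qpoch_inf (x ^ 4) (x ^ 4) = qpoch_inf (x ^ 2) (x ^ 2) * qpoch_inf (- (x ^ 2)) (x ^ 2)"
    using qpoch_inf_times_uminus[OF n(1), of "x ^ 2"] by simp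
  have 3: "qpoch_inf (- (x ^ 2)) (x ^ 2) = qpoch_inf (- (x ^ 2)) (x ^ 4) * qpoch_inf (- (x ^ 4)) (x ^ 4)"
    using qpoch_inf_even_odd[OF n(1), of "- (x ^ 2)"] by (simp flip: power_add)
  have psi: "ramanujan_psi (- x) = qpoch_inf x (x ^ 2) * qpoch_inf (x ^ 4) (x ^ 4)"
    using ramanujan_psi_product[of "- x"] assms by simp
  have psi2: "ramanujan_psi (x ^ 2) = qpoch_inf (- (x ^ 2)) (x ^ 4) * qpoch_inf (x ^ 8) (x ^ 8)"
    using ramanujan_psi_product[of "x ^ 2"] assms n by simp
  have "qpoch_inf (x ^ 4) (x ^ 4) ^ 2
      = qpoch_inf (x ^ 4) (x ^ 4) * (qpoch_inf (x ^ 2) (x ^ 2) * qpoch_inf (- (x ^ 2)) (x ^ 2))"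
    by (simp add: power2_eq_square[of "qpoch_inf (x ^ 4) (x ^ 4)"] flip: 2)
  also have "\<dots> = qpoch_inf (x ^ 2) (x ^ 2) * (qpoch_inf (- (x ^ 2)) (x ^ 4) * qpoch_inf (x ^ 8) (x ^ 8))"
    unfolding 1 3 by simp
  finally show ?thesis
    unfolding psi psi2 ramanujan_phi_uminus_product[OF assms] power_mult_distrib by simp
qed

section \<open>The quintic theta quotients\<close>

text \<open>Here e is 1 or -1; it cancels from every argument on the right and survives only in the
  prefactor. The bound on \<open>j\<close> keeps the natural-number subtractions exact.\<close>

lemma theta_times_power:
  assumes "q \<noteq> 0" "norm q < 1" "j \<le> i + 10" "e * e = 1"
  shows "theta (q ^ 10) (e * q ^ i) * theta (q ^ 10) (e * q ^ j)
    = theta (q ^ 20) (q ^ (i + j)) * theta (q ^ 20) (q ^ (i + 10 - j))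
    + e * q ^ i * theta (q ^ 20) (q ^ (i + j + 10)) * theta (q ^ 20) (q ^ (i + 20 - j))"
proof -
  have e: "e \<noteq> 0" using assms(4) by auto
  have "e * q ^ i * (e * q ^ j) = (e * e) * q ^ (i + j)" by (simp add: power_add)
  hence 1: "e * q ^ i * (e * q ^ j) = q ^ (i + j)" using assms(4) by simp
  have 2: "e * q ^ i * q ^ 10 / (e * q ^ j) = q ^ (i + 10 - j)"
    using assms e by (simp add: power_diff power_add)
  have 3: "e * q ^ i * (q ^ 10) ^ 2 / (e * q ^ j) = q ^ (i + 20 - j)"
    using assms e by (simp add: power_diff power_add flip: power_mult)
  have "theta (q ^ 10) (e * q ^ i) * theta (q ^ 10) (e * q ^ j)
    = theta ((q ^ 10) ^ 2) (e * q ^ i * (e * q ^ j)) * theta ((q ^ 10) ^ 2) (e * q ^ i * q ^ 10 / (e * q ^ j))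
    + e * q ^ i * theta ((q ^ 10) ^ 2) (e * q ^ i * (e * q ^ j) * q ^ 10)
      * theta ((q ^ 10) ^ 2) (e * q ^ i * (q ^ 10) ^ 2 / (e * q ^ j))"
    using assms e by (intro theta_times norm_power_less_one) auto
  thus ?thesis unfolding 1 2 3 by (simp add: power_add flip: power_mult)
qed

section \<open>Identities for a fixed nonzero q\<close>

context
  fixes q :: complex
  assumes q: "q \<noteq> 0" "norm q < 1"
begin

lemma theta_difference:
  "(theta (q ^ 10) (q ^ 4) * theta (q ^ 10) (- (q ^ 3)) - q * theta (q ^ 10) (q ^ 2) * theta (q ^ 10) (- q))
     * ramanujan_psi (- (q ^ 5)) ^ 2
   = theta (q ^ 10) (q ^ 2) * theta (q ^ 10) (q ^ 4) * (theta (q ^ 10) (- q) * theta (q ^ 10) (- (q ^ 3)))"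
proof -
  define F where "F k = theta (q ^ 20) (q ^ k)" for k
  \<comment> \<open>Reflection k -> 20 - k leaves only F 2, F 4, F 6 and F 8 as unknowns.\<close>
  have F: "F 18 = F 2" "F 16 = F 4" "F 14 = F 6" "F 12 = F 8"
    using q theta_reflect[of "q ^ 20" "q ^ 2"] theta_reflect[of "q ^ 20" "q ^ 4"]
      theta_reflect[of "q ^ 20" "q ^ 6"] theta_reflect[of "q ^ 20" "q ^ 8"]
    by (simp_all add: F_def flip: power_diff)
  note T = theta_times_power[OF q]
  \<comment> \<open>The exponents are supplied in the order j, i, the larger first. With i = 0 both
    summands coincide, hence the 2.\<close>
  have 1: "theta (q ^ 10) 1 * theta (q ^ 10) (q ^ 4) = 2 * F 4 * F 6"
    using T[of 4 0 1] F by (simp add: F_def)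
  have 2: "theta (q ^ 10) 1 * theta (q ^ 10) (q ^ 2) = 2 * F 2 * F 8"
    using T[of 2 0 1] F by (simp add: F_def power2_eq_square)
  have 3: "theta (q ^ 10) (q ^ 2) * theta (q ^ 10) (q ^ 4) = F 6 * F 8 + q ^ 2 * F 4 * F 2"
    using T[of 4 2 1] F by (simp add: F_def)
  have 4: "theta (q ^ 10) (- (q ^ 3)) * theta (q ^ 10) (- (q ^ 5)) = F 8 ^ 2 - q ^ 3 * F 2 ^ 2"
    using T[of 5 3 "- 1"] F by (simp add: F_def power2_eq_square)
  have 5: "theta (q ^ 10) (- q) * theta (q ^ 10) (- (q ^ 5)) = F 6 ^ 2 - q * F 4 ^ 2"
    using T[of 5 1 "- 1"] F by (simp add: F_def power2_eq_square)
  have 6: "theta (q ^ 10) (- q) * theta (q ^ 10) (- (q ^ 3)) = F 4 * F 8 - q * F 6 * F 2"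
    using T[of 3 1 "- 1"] F by (simp add: F_def)
  have "ramanujan_phi (- (q ^ 5)) = theta (q ^ 10) (- (q ^ 5))"
    using q by (simp add: ramanujan_phi_def ramanujan_f_eq_theta flip: power_add)
  moreover have "theta (q ^ 10) 1 = 2 * ramanujan_psi (q ^ 10)"
    using q by (intro theta_one_eq_psi norm_power_less_one) auto
  ultimately have "2 * ramanujan_psi (- (q ^ 5)) ^ 2 = theta (q ^ 10) 1 * theta (q ^ 10) (- (q ^ 5))"
    using ramanujan_psi_uminus_square[of "q ^ 5"] q by (simp add: norm_power_less_one flip: power_mult)
  hence "2 * ((theta (q ^ 10) (q ^ 4) * theta (q ^ 10) (- (q ^ 3)) - q * theta (q ^ 10) (q ^ 2) * theta (q ^ 10) (- q))
     * ramanujan_psi (- (q ^ 5)) ^ 2)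
     = (theta (q ^ 10) 1 * theta (q ^ 10) (q ^ 4)) * (theta (q ^ 10) (- (q ^ 3)) * theta (q ^ 10) (- (q ^ 5)))
      - q * (theta (q ^ 10) 1 * theta (q ^ 10) (q ^ 2)) * (theta (q ^ 10) (- q) * theta (q ^ 10) (- (q ^ 5)))"
    by algebra
  \<comment> \<open>The difference factors as a polynomial in the F's, and its two factors are the
    theta products of facts 3 and 6.\<close>
  also have "\<dots> = 2 * ((F 6 * F 8 + q ^ 2 * F 4 * F 2) * (F 4 * F 8 - q * F 6 * F 2))"
    unfolding 1 2 4 5 by algebra
  finally show ?thesis unfolding 3 6 by simp
qed

text \<open>This is \<open>theta_one_square\<close> at q^2; each \<open>theta _ 1\<close> is 2 psi,
  so a common factor 4 cancels.\<close>

lemma theta_product_eq_psi: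
  "theta (q ^ 10) (q ^ 2) * theta (q ^ 10) (q ^ 4) = ramanujan_psi (q ^ 2) ^ 2 - q ^ 2 * ramanujan_psi (q ^ 10) ^ 2"
proof -
  have "theta (q ^ 2) 1 ^ 2 = q ^ 2 * theta (q ^ 10) 1 ^ 2 + 4 * (theta (q ^ 10) (q ^ 2) * theta (q ^ 10) (q ^ 4))"
    using theta_one_square[of "q ^ 2"] q by (simp add: norm_power_less_one flip: power_mult)
  moreover have "theta (q ^ 2) 1 = 2 * ramanujan_psi (q ^ 2)" "theta (q ^ 10) 1 = 2 * ramanujan_psi (q ^ 10)"
    using q by (intro theta_one_eq_psi norm_power_less_one; simp)+
  ultimately have "4 * (theta (q ^ 10) (q ^ 2) * theta (q ^ 10) (q ^ 4))
      = 4 * (ramanujan_psi (q ^ 2) ^ 2 - q ^ 2 * ramanujan_psi (q ^ 10) ^ 2)"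
    by algebra
  thus ?thesis by (simp only: mult_cancel_left) simp
qed

text \<open>This is the formula for the product of \<open>Omega1 q\<close> and
  \<open>Omega2 q\<close> with denominators cleared; by the triple product both sides are infinite
  products.\<close>

lemma theta_product_quotient:
  "theta (q ^ 10) (q ^ 2) * theta (q ^ 10) (q ^ 4) * (ramanujan_phi (- q) * ramanujan_psi (q ^ 5))
   = ramanujan_phi (- (q ^ 10)) * ramanujan_psi (- q) * (theta (q ^ 10) (- q) * theta (q ^ 10) (- (q ^ 3)))"
proof -
  let ?Q = qpoch_inf
  have n: "norm (q ^ k) < 1" if "k > 0" for k using q(2) that by (rule norm_power_less_one)
  have J: "theta (q ^ 10) (e * q ^ k) = ?Q (- e * q ^ k) (q ^ 10) * ?Q (- e * q ^ (10 - k)) (q ^ 10) * ?Q (q ^ 10) (q ^ 10)"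
    if "e * e = 1" "k \<le> 10" for e k
  proof -
    have "e \<noteq> 0" "inverse e = e" using that by (auto simp: inverse_unique)
    hence "- (q ^ 10) / (e * q ^ k) = - e * q ^ (10 - k)"
      using q that by (simp add: power_diff divide_inverse)
    thus ?thesis using jacobi_triple_product[OF n, of 10 "e * q ^ k"] q \<open>e \<noteq> 0\<close> by simp
  qed
  have five: "?Q a (q ^ 2) = ?Q a (q ^ 10) * ?Q (a * q ^ 2) (q ^ 10) * ?Q (a * q ^ 4) (q ^ 10)
      * ?Q (a * q ^ 6) (q ^ 10) * ?Q (a * q ^ 8) (q ^ 10)" for a
    using qpoch_inf_dissect[of "q ^ 2" 5 a] n[of 2]
    by (simp add: lessThan_nat_numeral lessThan_Suc mult_ac flip: power_mult)
  \<comment> \<open>The two theta functions cover the exponents 2, 4, 6, 8 modulo 10; the extra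
    factor supplies the class of 10. In \<open>E2\<close> the classes 1, 3, 7, 9 are completed by
    that of 5.\<close>
  have E1: "theta (q ^ 10) (q ^ 2) * theta (q ^ 10) (q ^ 4) * ?Q (- (q ^ 10)) (q ^ 10)
      = ?Q (- (q ^ 2)) (q ^ 2) * ?Q (q ^ 10) (q ^ 10) ^ 2"
    using J[of 1 2] J[of 1 4] five[of "- (q ^ 2)"]
    by (simp add: power2_eq_square[of "?Q (q ^ 10) (q ^ 10)"] mult_ac flip: power_add)
  have E2: "theta (q ^ 10) (- q) * theta (q ^ 10) (- (q ^ 3)) * ?Q (q ^ 5) (q ^ 10)
      = ?Q q (q ^ 2) * ?Q (q ^ 10) (q ^ 10) ^ 2"
    using J[of "- 1" 1] J[of "- 1" 3] five[of q]
    by (simp add: power2_eq_square[of "?Q (q ^ 10) (q ^ 10)"] mult_ac flip: power_Suc)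
  have E3: "?Q (q ^ 2) (q ^ 2) * ?Q (- (q ^ 2)) (q ^ 2) = ?Q (q ^ 4) (q ^ 4)"
    using qpoch_inf_times_uminus[of "q ^ 2" "q ^ 2"] n[of 2] by simp
  have E4: "?Q (q ^ 10) (q ^ 10) * ?Q (- (q ^ 10)) (q ^ 10) = ?Q (q ^ 20) (q ^ 20)"
    using qpoch_inf_times_uminus[of "q ^ 10" "q ^ 10"] n[of 10] by simp
  have E5: "?Q (q ^ 5) (q ^ 10) * ?Q (- (q ^ 5)) (q ^ 10) = ?Q (q ^ 10) (q ^ 20)"
    using qpoch_inf_times_uminus[of "q ^ 10" "q ^ 5"] n[of 10] by simp
  have E6: "?Q (q ^ 10) (q ^ 10) = ?Q (q ^ 10) (q ^ 20) * ?Q (q ^ 20) (q ^ 20)"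
    using qpoch_inf_even_odd[of "q ^ 10" "q ^ 10"] n[of 10] by (simp flip: power_add)
  have phi: "ramanujan_phi (- q) = ?Q q (q ^ 2) ^ 2 * ?Q (q ^ 2) (q ^ 2)"
    using q by (rule ramanujan_phi_uminus_product)
  have phi10: "ramanujan_phi (- (q ^ 10)) = ?Q (q ^ 10) (q ^ 20) ^ 2 * ?Q (q ^ 20) (q ^ 20)"
    using ramanujan_phi_uminus_product[of "q ^ 10"] n[of 10] q by simp
  have psi: "ramanujan_psi (- q) = ?Q q (q ^ 2) * ?Q (q ^ 4) (q ^ 4)"
    using ramanujan_psi_product[of "- q"] q by simp
  have psi5: "ramanujan_psi (q ^ 5) = ?Q (- (q ^ 5)) (q ^ 10) * ?Q (q ^ 20) (q ^ 20)"
    using ramanujan_psi_product[of "q ^ 5"] n[of 5] q by simp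
  have "?Q (q ^ 5) (q ^ 10) \<noteq> 0" "?Q (q ^ 20) (q ^ 20) \<noteq> 0" "?Q (q ^ 10) (q ^ 10) \<noteq> 0"
    using n by (simp_all add: qpoch_inf_nonzero)
  moreover have "?Q (- (q ^ 10)) (q ^ 10) \<noteq> 0"
    using n by (simp add: qpoch_inf_nonzero)
  \<comment> \<open>Both sides are multiplied by the nonzero completing factors of \<open>E1\<close>
    and \<open>E2\<close>, and then reduce to the same product.\<close>
  moreover have "(theta (q ^ 10) (q ^ 2) * theta (q ^ 10) (q ^ 4) * (ramanujan_phi (- q) * ramanujan_psi (q ^ 5)))
        * (?Q (q ^ 5) (q ^ 10) * ?Q (- (q ^ 10)) (q ^ 10))
     = (ramanujan_phi (- (q ^ 10)) * ramanujan_psi (- q) * (theta (q ^ 10) (- q) * theta (q ^ 10) (- (q ^ 3))))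
        * (?Q (q ^ 5) (q ^ 10) * ?Q (- (q ^ 10)) (q ^ 10))" (is "?L = ?R")
  proof -
    have "?L = (theta (q ^ 10) (q ^ 2) * theta (q ^ 10) (q ^ 4) * ?Q (- (q ^ 10)) (q ^ 10))
        * ?Q q (q ^ 2) ^ 2 * ?Q (q ^ 2) (q ^ 2) * (?Q (q ^ 5) (q ^ 10) * ?Q (- (q ^ 5)) (q ^ 10)) * ?Q (q ^ 20) (q ^ 20)"
      unfolding phi psi5 by simp
    also have "\<dots> = (?Q (q ^ 2) (q ^ 2) * ?Q (- (q ^ 2)) (q ^ 2)) * ?Q (q ^ 10) (q ^ 10) ^ 2 * ?Q q (q ^ 2) ^ 2
        * (?Q (q ^ 10) (q ^ 20) * ?Q (q ^ 20) (q ^ 20))"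
      unfolding E1 E5 by simp
    also have "\<dots> = ?Q (q ^ 4) (q ^ 4) * ?Q (q ^ 10) (q ^ 10) ^ 3 * ?Q q (q ^ 2) ^ 2"
      unfolding E3 E6[symmetric] by (simp add: power3_eq_cube power2_eq_square)
    finally have L: "?L = \<dots>" .
    have "?R = (theta (q ^ 10) (- q) * theta (q ^ 10) (- (q ^ 3)) * ?Q (q ^ 5) (q ^ 10))
        * ?Q (q ^ 10) (q ^ 20) * (?Q (q ^ 10) (q ^ 20) * ?Q (q ^ 20) (q ^ 20))
        * ?Q q (q ^ 2) * ?Q (q ^ 4) (q ^ 4) * ?Q (- (q ^ 10)) (q ^ 10)"
      unfolding phi10 psi by (simp add: power2_eq_square)
    also have "\<dots> = ?Q q (q ^ 2) ^ 2 * ?Q (q ^ 4) (q ^ 4) * ?Q (q ^ 10) (q ^ 10) ^ 2 * ?Q (q ^ 10) (q ^ 20)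
        * (?Q (q ^ 10) (q ^ 10) * ?Q (- (q ^ 10)) (q ^ 10))"
      unfolding E2 E6[symmetric] by (simp add: power2_eq_square)
    also have "\<dots> = ?Q q (q ^ 2) ^ 2 * ?Q (q ^ 4) (q ^ 4) * ?Q (q ^ 10) (q ^ 10) ^ 2
        * (?Q (q ^ 10) (q ^ 20) * ?Q (q ^ 20) (q ^ 20))"
      unfolding E4 by simp
    also have "\<dots> = ?Q (q ^ 4) (q ^ 4) * ?Q (q ^ 10) (q ^ 10) ^ 3 * ?Q q (q ^ 2) ^ 2"
      unfolding E6[symmetric] by (simp add: power3_eq_cube power2_eq_square)
    finally show ?thesis using L by simp
  qed
  ultimately show ?thesis by simp
qed

text \<open>The factors of the triple product start at q^k, q^(10-k) and q^10, all of norm below 1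
  for 0 < k < 10.\<close>

lemma theta_uminus_nonzero:
  assumes "0 < k" "k < 10"
  shows "theta (q ^ 10) (- (q ^ k)) \<noteq> 0"
proof -
  have "- (q ^ 10) / - (q ^ k) = q ^ (10 - k)" using assms q by (simp add: power_diff)
  thus ?thesis
    using jacobi_triple_product[of "q ^ 10" "- (q ^ k)"] assms q
    by (simp add: qpoch_inf_nonzero norm_power_less_one)
qed

lemma Omega1_eq_theta: "Omega1 q = theta (q ^ 10) (q ^ 4) / theta (q ^ 10) (- q)"
  using q by (simp add: Omega1_def ramanujan_f_eq_theta flip: power_add power_Suc)

lemma Omega2_eq_theta: "Omega2 q = q * theta (q ^ 10) (q ^ 2) / theta (q ^ 10) (- (q ^ 3))"
  using q by (simp add: Omega2_def ramanujan_f_eq_theta flip: power_add)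

lemma Omega1_minus_Omega2:
  "Omega1 q - Omega2 q
   = (ramanujan_psi (q ^ 2) ^ 2 - q ^ 2 * ramanujan_psi (q ^ 10) ^ 2) / ramanujan_psi (- (q ^ 5)) ^ 2"
proof -
  have "theta (q ^ 10) (- q) \<noteq> 0" "theta (q ^ 10) (- (q ^ 3)) \<noteq> 0"
    using theta_uminus_nonzero[of 1] theta_uminus_nonzero[of 3] by simp_all
  moreover have "ramanujan_psi (- (q ^ 5)) \<noteq> 0"
    using q by (intro ramanujan_psi_nonzero) (auto simp: norm_power_less_one)
  ultimately show ?thesis
    using theta_difference unfolding Omega1_eq_theta Omega2_eq_theta theta_product_eq_psi[symmetric]
    by (simp add: field_simps)
qed

lemma Omega1_times_Omega2:
  "Omega1 q * Omega2 q = q * ramanujan_phi (- (q ^ 10)) * ramanujan_psi (- q)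
     / (ramanujan_phi (- q) * ramanujan_psi (q ^ 5))"
proof -
  have "theta (q ^ 10) (- q) \<noteq> 0" "theta (q ^ 10) (- (q ^ 3)) \<noteq> 0"
    using theta_uminus_nonzero[of 1] theta_uminus_nonzero[of 3] by simp_all
  moreover have "ramanujan_psi (q ^ 5) \<noteq> 0"
    using q by (intro ramanujan_psi_nonzero) (auto simp: norm_power_less_one)
  moreover have "ramanujan_phi (- q) \<noteq> 0"
    using q by (rule ramanujan_phi_uminus_nonzero)
  ultimately show ?thesis
    using theta_product_quotient unfolding Omega1_eq_theta Omega2_eq_theta
    by (simp add: field_simps)
qed

end

section \<open>The case q = 0 and the conclusion\<close>

lemma ramanujan_f_0_0: "ramanujan_f 0 0 = 1"
proof -
  have "(0::complex) ^ nat (n * (n + 1) div 2) * 0 ^ nat (n * (n - 1) div 2) = 0" if "n \<noteq> 0" for n :: int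
  proof -
    \<comment> \<open>For n > 0 the first exponent is at least 1, for n < 0 the second; only n = 0
      survives, as 0 ^ 0 = 1.\<close>
    have "nat (n * (n + 1) div 2) + nat (n * (n - 1) div 2) > 0"
    proof (cases "n > 0")
      case True
      hence "n * (n + 1) \<ge> 1 * 2" by (intro mult_mono) auto
      from zdiv_mono1[OF this, of 2] show ?thesis by simp
    next
      case False
      hence "(- n) * (1 - n) \<ge> 1 * 2" using that by (intro mult_mono) auto
      hence "n * (n - 1) \<ge> 2" by (simp add: algebra_simps)
      from zdiv_mono1[OF this, of 2] show ?thesis by simp
    qed
    thus ?thesis by (simp flip: power_add)
  qed
  hence "ramanujan_f 0 0
      = (\<Sum>\<^sub>\<infinity>n\<in>{0::int}. (0::complex) ^ nat (n * (n + 1) div 2) * 0 ^ nat (n * (n - 1) div 2))"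
    unfolding ramanujan_f_def by (intro infsum_cong_neutral) auto
  thus ?thesis by simp
qed

theorem theorem3p3:
  fixes q :: complex
  assumes "norm q < 1"
  shows "Omega1 q ^ 2 + Omega2 q ^ 2 =
      ramanujan_psi (q ^ 2) ^ 4 / ramanujan_psi (- (q ^ 5)) ^ 4
    + q ^ 4 * ramanujan_psi (q ^ 10) ^ 4 / ramanujan_psi (- (q ^ 5)) ^ 4
    - 2 * q ^ 2 * ramanujan_psi (q ^ 2) ^ 2 * ramanujan_psi (q ^ 10) ^ 2
        / ramanujan_psi (- (q ^ 5)) ^ 4
    + 2 * q * ramanujan_phi (- (q ^ 10)) * ramanujan_psi (- q)
        / (ramanujan_phi (- q) * ramanujan_psi (q ^ 5))"
proof (cases "q = 0")
  case True
  \<comment> \<open>All theta values are f(0, 0) = 1 and \<open>Omega2 0 = 0\<close>, so both sides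
    equal 1.\<close>
  thus ?thesis
    by (simp add: Omega1_def Omega2_def ramanujan_psi_def ramanujan_phi_def ramanujan_f_0_0)
next
  case False
  let ?A = "ramanujan_psi (q ^ 2)" and ?B = "ramanujan_psi (q ^ 10)" and ?C = "ramanujan_psi (- (q ^ 5))"
  have "Omega1 q ^ 2 + Omega2 q ^ 2 = (Omega1 q - Omega2 q) ^ 2 + 2 * (Omega1 q * Omega2 q)"
    by (simp add: power2_eq_square algebra_simps)
  also have "(Omega1 q - Omega2 q) ^ 2 = (?A ^ 2 - q ^ 2 * ?B ^ 2) ^ 2 / ?C ^ 4"
    using Omega1_minus_Omega2[OF False assms] by (simp add: power_divide)
  also have "(?A ^ 2 - q ^ 2 * ?B ^ 2) ^ 2 = ?A ^ 4 + q ^ 4 * ?B ^ 4 - 2 * q ^ 2 * ?A ^ 2 * ?B ^ 2"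
    by algebra
  finally show ?thesis
    unfolding Omega1_times_Omega2[OF False assms] by (simp add: add_divide_distrib diff_divide_distrib mult.assoc)
qed

end
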